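(* Let $G$ be a finite simple graph with no isolated vertices that is $C_5$-free and not isomorphic to any of the following graphs: (1) $K_{2,m}$ for some $m\ge 2$; (2) the wheel consisting of a $4$-cycle plus one vertex adjacent to all four cycle vertices; (3) $K_{2,2,2}$; (4) the cycle $C_6$; (5) $2K_2$; (6) the path $P_5$; (7) the graph with vertices $a,b,c,d,e$ and edges $ab,bc,ca,cd,de$; (8) the bowtie (two triangles sharing exactly one vertex). Then $G$ is pseudo-split if and only if $G/e$ is pseudo-split for every edge $e\in E(G)$.
   Context: All graphs are finite and simple. A graph is pseudo-split if it has no induced subgraph isomorphic to $2K_2$ (two disjoint edges) or to the cycle $C_4$. For an edge $e=uv$ of $G$, the contraction $G/e$ is obtained from $G$ by deleting $u$ and $v$ and adding a new vertex adjacent to every vertex of $(N(u)\cup N(v))\setminus\{u,v\}$. *)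

theory Defs
  imports "Graph_Theory.Graph_Theory"
begin

text \<open>
  A finite simple graph is a \<^locale>\<open>pair_graph\<close>: a finite, symmetric, loop-free set of arcs.
  An undirected edge \<open>uv\<close> is thus represented by the two arcs \<open>(u, v)\<close> and \<open>(v, u)\<close>.
\<close>

definition nbhd :: "'a pair_pre_digraph \<Rightarrow> 'a \<Rightarrow> 'a set" where
  "nbhd G v = {w. (v, w) \<in> parcs G}"

definition no_isolated_vertices :: "'a pair_pre_digraph \<Rightarrow> bool" where
  "no_isolated_vertices G \<longleftrightarrow> (\<forall>v \<in> pverts G. nbhd G v \<noteq> {})"

definition induced_free :: "'b pair_pre_digraph \<Rightarrow> 'a pair_pre_digraph \<Rightarrow> bool" where
  "induced_free H G \<longleftrightarrow>
     \<not> (\<exists>K. induced_subgraph K (with_proj G) \<and> digraph_iso K (with_proj H))"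

definition graph_on :: "nat \<Rightarrow> (nat \<times> nat) set \<Rightarrow> nat pair_pre_digraph" where
  "graph_on n E = \<lparr>pverts = {..<n}, parcs = E \<union> E\<inverse>\<rparr>"

definition cycle_graph :: "nat \<Rightarrow> nat pair_pre_digraph" where
  "cycle_graph n = graph_on n {(i, Suc i mod n) | i. i < n}"

definition path_graph :: "nat \<Rightarrow> nat pair_pre_digraph" where
  "path_graph n = graph_on n {(i, Suc i) | i. Suc i < n}"

definition two_K2 :: "nat pair_pre_digraph" where
  "two_K2 = graph_on 4 {(0, 1), (2, 3)}"

definition wheel4 :: "nat pair_pre_digraph" where
  "wheel4 = graph_on 5 (parcs (cycle_graph 4) \<union> {4} \<times> {..<4})"

text \<open>The parts of $K_{2,2,2}$ are \<open>{0, 1}\<close>, \<open>{2, 3}\<close> and \<open>{4, 5}\<close>.\<close>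

definition K222 :: "nat pair_pre_digraph" where
  "K222 = graph_on 6 {(i, j). i < 6 \<and> j < 6 \<and> i div 2 \<noteq> j div 2}"

definition triangle_with_tail :: "nat pair_pre_digraph" where
  "triangle_with_tail = graph_on 5 {(0, 1), (1, 2), (2, 0), (2, 3), (3, 4)}"

definition bowtie :: "nat pair_pre_digraph" where
  "bowtie = graph_on 5 {(0, 1), (1, 2), (2, 0), (2, 3), (3, 4), (4, 2)}"

definition pseudo_split :: "'a pair_pre_digraph \<Rightarrow> bool" where
  "pseudo_split G \<longleftrightarrow> induced_free two_K2 G \<and> induced_free (cycle_graph 4) G"

text \<open>
  The vertex created by the contraction is \<^term>\<open>None\<close>; the surviving vertices are tagged with
  \<^term>\<open>Some\<close>. The result does not depend on the orientation of the edge.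
\<close>

definition contract :: "'a pair_pre_digraph \<Rightarrow> 'a \<times> 'a \<Rightarrow> 'a option pair_pre_digraph" where
  "contract G = (\<lambda>(u, v). let N = (nbhd G u \<union> nbhd G v) - {u, v} in
     \<lparr>pverts = insert None (Some ` (pverts G - {u, v})),
      parcs = {(Some x, Some y) | x y. (x, y) \<in> parcs G \<and> x \<notin> {u, v} \<and> y \<notin> {u, v}}
        \<union> {(None, Some x) | x. x \<in> N} \<union> {(Some x, None) | x. x \<in> N}\<rparr>)"

lemma contract_swap: "contract G (u, v) = contract G (v, u)"
  by (auto simp: contract_def Let_def)

lemma pair_graphI:
  assumes "finite (pverts G)" "parcs G \<subseteq> pverts G \<times> pverts G" "sym (parcs G)" "irrefl (parcs G)"
  shows "pair_graph G"
proof -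
  have "finite (parcs G)"
    using assms(1,2) by (meson finite_SigmaI finite_subset)
  then show ?thesis
    using assms by unfold_locales (auto simp: symmetric_def irrefl_def)
qed

lemma pair_graph_contract:
  assumes "pair_graph G"
  shows "pair_graph (contract G e)"
proof -
  interpret pair_graph G by fact
  have s: "(y, x) \<in> parcs G" if "(x, y) \<in> parcs G" for x y
    using that pair_sym_arcs by (auto simp: symmetric_def dest: symD)
  have "finite (pverts G)" by (rule pair_finite_verts)
  then show ?thesis
    by (intro pair_graphI)
      (auto simp: contract_def nbhd_def Let_def irrefl_def sym_def
        intro: s dest: in_arcsD1 in_arcsD2 pair_no_loops split: prod.splits)
qed

lemma pair_graph_graph_on:
  assumes "E \<subseteq> {..<n} \<times> {..<n}" "irrefl E"
  shows "pair_graph (graph_on n E)"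
  using assms by (intro pair_graphI) (auto simp: graph_on_def irrefl_def sym_def)

lemma pair_graph_cycle_graph: "n \<ge> 2 \<Longrightarrow> pair_graph (cycle_graph n)"
  unfolding cycle_graph_def
  by (rule pair_graph_graph_on) (auto simp: irrefl_def mod_Suc intro: gr0I split: if_splits)

lemma pair_graph_path_graph: "pair_graph (path_graph n)"
  unfolding path_graph_def
  by (rule pair_graph_graph_on) (auto simp: irrefl_def)

lemma pair_graph_named:
  "pair_graph two_K2" "pair_graph wheel4" "pair_graph K222"
  "pair_graph triangle_with_tail" "pair_graph bowtie"
proof -
  show "pair_graph wheel4"
    unfolding wheel4_def
    by (rule pair_graph_graph_on)
      (auto simp: irrefl_def cycle_graph_def graph_on_def mod_Suc split: if_splits)
qed (auto simp: two_K2_def K222_def triangle_with_tail_def bowtie_def irrefl_def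
       intro!: pair_graph_graph_on)

end

theory Submission
  imports Defs
begin

text \<open>
  An induced $2K_2$ or $C_4$ of $G/e$ lifts to an induced $2K_2$, $C_4$ or $C_5$ of $G$, which gives
  one direction. Conversely, fix an induced $2K_2$ or $C_4$ in $G$. Contracting an edge that avoids
  it would leave it intact, so the outside vertices form an independent set; contracting an edge
  that meets it severely restricts the possible neighbourhoods of outside vertices.

  For an induced $2K_2$, every outside vertex sees both edges, and no two outside vertices have a
  common neighbour. Hence there are at most two of them, which leaves $2K_2$, then $P_5$, the
  triangle with a tail and the bowtie, and finally $C_6$.

  For an induced $C_4$, every outside vertex is adjacent to both or to neither end of each
  non-adjacent pair, in the same way for all outside vertices. If all of them miss
  one pair, then $G$ is $K_{2,m}$; otherwise all are complete to the cycle and there are one or two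
  of them, which gives the wheel and $K_{2,2,2}$.
\<close>

section \<open>Isomorphisms and induced subgraphs as vertex lists with prescribed
  adjacencies\<close>

lemma digraph_iso_graph_onI:
  assumes G: "pair_graph G" and V: "pverts G = set xs" and d: "distinct xs" and n: "length xs = n"
    and E: "E \<subseteq> {..<n} \<times> {..<n}" "\<And>i. (i, i) \<notin> E"
    and adj: "\<forall>j<n. \<forall>i<j. (xs ! i, xs ! j) \<in> parcs G \<longleftrightarrow> (i, j) \<in> E \<or> (j, i) \<in> E"
  shows "digraph_iso (with_proj G) (with_proj (graph_on n E))"
proof -
  interpret pair_graph G by fact
  have sym: "(x, y) \<in> parcs G \<longleftrightarrow> (y, x) \<in> parcs G" for x y
    using pair_sym_arcs by (auto simp: symmetric_def dest: symD)
  have loop: "(x, x) \<notin> parcs G" for x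
    using pair_no_loops by fastforce
  \<comment> \<open>Testing pairs with \<open>i < j\<close> suffices: symmetry covers
    \<open>i > j\<close>, and the absence of loops in both \<open>G\<close> and \<open>E\<close>
    covers \<open>i = j\<close>.\<close>
  have adj': "(xs ! i, xs ! j) \<in> parcs G \<longleftrightarrow> (i, j) \<in> E \<or> (j, i) \<in> E" if "i < n" "j < n" for i j
    using that adj[rule_format, of i j] adj[rule_format, of j i] sym loop E(2)
    by (cases i j rule: linorder_cases) auto
  define f where "f = the_inv_into {..<n} ((!) xs)"
  have inj: "inj_on ((!) xs) {..<n}"
    using d n by (auto simp: inj_on_nth)
  have img: "(!) xs ` {..<n} = pverts G"
    using V n by (auto simp: set_conv_nth)
  have f_nth: "f (xs ! i) = i" if "i < n" for i
    using that inj by (simp add: f_def the_inv_into_f_f)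
  have nth_f: "f v < n" "xs ! f v = v" if "v \<in> pverts G" for v
    using that f_nth by (auto simp flip: img)
  have bij: "bij_betw f (pverts G) {..<n}"
    using inj img unfolding f_def by (metis bij_betw_def bij_betw_the_inv_into)
  \<comment> \<open>On both sides an arc is the pair of its ends, so the position map
    \<open>f\<close> acts on arcs componentwise, and head and tail stay the projections.\<close>
  define h where "h = \<lparr>iso_verts = f, iso_arcs = map_prod f f, iso_head = snd, iso_tail = fst\<rparr>"
  have arcs: "map_prod f f ` parcs G = E \<union> E\<inverse>"
  proof (intro equalityI subsetI)
    fix p assume "p \<in> map_prod f f ` parcs G"
    then obtain x y where p: "p = (f x, f y)" and xy: "(x, y) \<in> parcs G"
      by auto
    then have "x \<in> pverts G" "y \<in> pverts G"
      by (auto dest: in_arcsD1 in_arcsD2)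
    with xy show "p \<in> E \<union> E\<inverse>"
      using adj'[of "f x" "f y"] by (auto simp: p nth_f)
  next
    fix p assume p: "p \<in> E \<union> E\<inverse>"
    obtain i j where ij: "p = (i, j)" by (cases p)
    with p E have "i < n" "j < n" by auto
    with p ij adj'[of i j] f_nth show "p \<in> map_prod f f ` parcs G"
      by (auto intro!: image_eqI[of _ _ "(xs ! i, xs ! j)"])
  qed
  have f_inj: "inj_on f (pverts G)"
    using bij by (simp add: bij_betw_def)
  have "inj_on (map_prod f f) (parcs G)"
    by (rule inj_on_subset[OF map_prod_inj_on[OF f_inj f_inj]]) (auto dest: in_arcsD1 in_arcsD2)
  then have "pre_digraph.digraph_isomorphism (with_proj G) h"
    using f_inj wf_digraph_axioms
    by (auto simp: pre_digraph.digraph_isomorphism_def h_def)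
  moreover have "with_proj (graph_on n E) = app_iso h (with_proj G)"
    using bij arcs by (simp add: with_proj_def graph_on_def app_iso_def h_def bij_betw_def)
  ultimately show ?thesis
    unfolding digraph_iso_def by blast
qed

text \<open>This replaces subgraphs and isomorphisms by a list of distinct vertices: its
  \<open>i\<close>-th entry plays the role of vertex \<open>i\<close> of the pattern. All later
  arguments work with such vertex lists only.\<close>

lemma induced_free_graph_on_iff:
  assumes G: "pair_graph G" and E: "E \<subseteq> {..<n} \<times> {..<n}" "\<And>i. (i, i) \<notin> E"
  shows "induced_free (graph_on n E) G \<longleftrightarrow>
    \<not> (\<exists>xs. length xs = n \<and> distinct xs \<and> set xs \<subseteq> pverts G \<and>
      (\<forall>j<n. \<forall>i<j. (xs ! i, xs ! j) \<in> parcs G \<longleftrightarrow> (i, j) \<in> E \<or> (j, i) \<in> E))"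
    (is "_ \<longleftrightarrow> \<not> ?emb")
proof -
  interpret pair_graph G by fact
  let ?H = "graph_on n E"
  interpret H: pair_graph ?H
    using E by (intro pair_graph_graph_on) (auto simp: irrefl_def)
  have "?emb" if K: "induced_subgraph K (with_proj G)" and iso: "digraph_iso K (with_proj ?H)" for K
  proof -
    have wf: "wf_digraph K"
      using K by (rule wf_digraphI_induced)
    \<comment> \<open>The isomorphism is reversed so that it starts from the concrete pattern; the
      images of \<open>0\<close>, ..., \<open>n - 1\<close> then form the list.\<close>
    obtain h where h: "H.digraph_isomorphism h" and K_eq: "K = app_iso h (with_proj ?H)"
      using digraph_iso_swap[OF wf iso] by (auto simp: digraph_iso_def)
    let ?f = "iso_verts h"
    have inj: "inj_on ?f {..<n}"
      using h H.digraph_isomorphism_inj_on_verts by (auto simp: graph_on_def)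
    have vK: "verts K = ?f ` {..<n}"
      by (simp add: K_eq graph_on_def)
    have "compatible (with_proj G) K" and VG: "verts K \<subseteq> pverts G"
      and AK: "arcs K = {e \<in> parcs G. fst e \<in> verts K \<and> snd e \<in> verts K}"
      using K by (auto simp: induced_subgraph_def subgraph_def compatible_def)
    \<comment> \<open>\<open>K\<close> inherits the projections of \<open>G\<close> as head and
      tail, so its arcs are their own pairs of ends. Hence they can be described by the vertex map
      alone, whatever \<open>h\<close> does on arcs.\<close>
    then have "arcs_ends K = arcs K"
      by (auto simp: arcs_ends_conv compatible_def)
    then have aK: "arcs K = (\<lambda>(u, v). (?f u, ?f v)) ` (E \<union> E\<inverse>)"
      using H.arcs_ends_app_iso_eq[OF h] by (simp add: K_eq graph_on_def)
    have adj: "(?f i, ?f j) \<in> parcs G \<longleftrightarrow> (i, j) \<in> E \<or> (j, i) \<in> E" if "i < n" "j < n" for i j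
    proof -
      have "(?f i, ?f j) \<in> parcs G \<longleftrightarrow> (?f i, ?f j) \<in> arcs K"
        using that by (auto simp: AK vK)
      also have "\<dots> \<longleftrightarrow> (i, j) \<in> E \<union> E\<inverse>"
      proof
        assume "(?f i, ?f j) \<in> arcs K"
        then obtain k l where kl: "(k, l) \<in> E \<union> E\<inverse>" "?f i = ?f k" "?f j = ?f l"
          by (auto simp: aK)
        moreover from kl E(1) have "k < n" "l < n" by auto
        ultimately show "(i, j) \<in> E \<union> E\<inverse>"
          using inj that by (auto dest: inj_onD)
      qed (force simp: aK)
      finally show ?thesis by simp
    qed
    show ?emb
      using inj VG vK adj
      by (intro exI[of _ "map ?f [0..<n]"]) (auto simp: distinct_map atLeast0LessThan)
  qed
  moreover have "\<exists>K. induced_subgraph K (with_proj G) \<and> digraph_iso K (with_proj ?H)" if emb: ?emb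
  proof -
    obtain xs where xs: "length xs = n" "distinct xs" "set xs \<subseteq> pverts G"
      and adj: "\<forall>j<n. \<forall>i<j. (xs ! i, xs ! j) \<in> parcs G \<longleftrightarrow> (i, j) \<in> E \<or> (j, i) \<in> E"
      using emb by blast
    define K where "K = \<lparr>pverts = set xs, parcs = parcs G \<inter> set xs \<times> set xs\<rparr>"
    have K: "pair_graph K"
      using pair_sym_arcs
      by (intro pair_graphI)
        (auto simp: K_def irrefl_def sym_def symmetric_def dest: pair_no_loops)
    have "digraph_iso (with_proj K) (with_proj ?H)"
      using K xs E adj by (intro digraph_iso_graph_onI[where xs = xs]) (auto simp: K_def)
    moreover have "induced_subgraph (with_proj K) (with_proj G)"
    proof -
      interpret K: pair_graph K by fact
      show ?thesis
        using xs wf_digraph_axioms K.wf_digraph_axioms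
        by (auto simp: induced_subgraph_def subgraph_def K_def compatible_def)
    qed
    ultimately show ?thesis by blast
  qed
  ultimately show ?thesis
    unfolding induced_free_def by blast
qed

section \<open>Explicit descriptions of induced 2K2, C4 and C5\<close>

definition ind_2K2 :: "'a rel \<Rightarrow> 'a \<Rightarrow> 'a \<Rightarrow> 'a \<Rightarrow> 'a \<Rightarrow> bool" where
  "ind_2K2 R a b c d \<longleftrightarrow> (a, b) \<in> R \<and> (c, d) \<in> R \<and>
     (a, c) \<notin> R \<and> (a, d) \<notin> R \<and> (b, c) \<notin> R \<and> (b, d) \<notin> R"

definition ind_C4 :: "'a rel \<Rightarrow> 'a \<Rightarrow> 'a \<Rightarrow> 'a \<Rightarrow> 'a \<Rightarrow> bool" where
  "ind_C4 R a b c d \<longleftrightarrow> (a, b) \<in> R \<and> (b, c) \<in> R \<and> (c, d) \<in> R \<and> (a, d) \<in> R \<and>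
     (a, c) \<notin> R \<and> (b, d) \<notin> R \<and> a \<noteq> c \<and> b \<noteq> d"

lemma ex_list4: "(\<exists>xs. length xs = 4 \<and> P xs) \<longleftrightarrow> (\<exists>a b c d. P [a, b, c, d])"
proof
  assume "\<exists>a b c d. P [a, b, c, d]"
  then obtain a b c d where "P [a, b, c, d]" by blast
  then show "\<exists>xs. length xs = 4 \<and> P xs"
    by (intro exI[of _ "[a, b, c, d]"]) simp
qed (auto simp: numeral_eq_Suc length_Suc_conv)

lemma all_less_Suc_nat: "(\<forall>i<Suc n. P i) \<longleftrightarrow> (\<forall>i<n. P i) \<and> P n" for n :: nat
  by (auto simp: less_Suc_eq)

text \<open>As an image of an initial segment, the edge set can be evaluated by simplification for
  each concrete \<open>n\<close>.\<close>

lemma cycle_graph_conv_image: "cycle_graph n = graph_on n ((\<lambda>i. (i, Suc i mod n)) ` {..<n})"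
  unfolding cycle_graph_def by (rule arg_cong[where f = "graph_on n"]) blast
lemma cycle_graph_numeral:
  "cycle_graph 4 = graph_on 4 {(0, 1), (1, 2), (2, 3), (3, 0)}"
  "cycle_graph 5 = graph_on 5 {(0, 1), (1, 2), (2, 3), (3, 4), (4, 0)}"
  "cycle_graph 6 = graph_on 6 {(0, 1), (1, 2), (2, 3), (3, 4), (4, 5), (5, 0)}"
  by (simp_all add: cycle_graph_conv_image lessThan_nat_numeral lessThan_Suc insert_commute flip: numeral_2_eq_2)
lemma path_graph_5: "path_graph 5 = graph_on 5 {(0, 1), (1, 2), (2, 3), (3, 4)}"
proof -
  have "{(i, Suc i) | i. Suc i < 5} = (\<lambda>i. (i, Suc i)) ` {..<4}"
    by auto
  then show ?thesis
    by (simp add: path_graph_def lessThan_nat_numeral lessThan_Suc insert_commute flip: numeral_2_eq_2)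
qed

lemma all_less_numeral:
  "(\<forall>i<numeral k. P i) \<longleftrightarrow> (\<forall>i<pred_numeral k. P i) \<and> P (pred_numeral k)" for P :: "nat \<Rightarrow> bool"
  by (simp add: numeral_eq_Suc all_less_Suc_nat)

context pair_graph
begin

lemma adj_sym: "(x, y) \<in> parcs G \<longleftrightarrow> (y, x) \<in> parcs G"
  using pair_sym_arcs by (auto simp: symmetric_def dest: symD)

lemma adj_irrefl: "(x, x) \<notin> parcs G"
  using pair_no_loops by fastforce

text \<open>Identifying vertices of different edges would turn a required non-edge into an edge, and
  the ends of one edge differ because there are no loops. So \<open>ind_2K2\<close> carries no
  inequalities, whereas \<open>ind_C4\<close> must state that opposite vertices differ.\<close>

lemma ind_2K2_distinct:
  "ind_2K2 (parcs G) a b c d \<Longrightarrow> distinct [a, b, c, d] \<and> {a, b, c, d} \<subseteq> pverts G"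
  using adj_sym adj_irrefl by (auto simp: ind_2K2_def dest: in_arcsD1 in_arcsD2)

lemma ind_C4_distinct:
  "ind_C4 (parcs G) a b c d \<Longrightarrow> distinct [a, b, c, d] \<and> {a, b, c, d} \<subseteq> pverts G"
  using adj_sym adj_irrefl by (auto simp: ind_C4_def dest: in_arcsD1 in_arcsD2)

lemma induced_free_two_K2_iff:
  "induced_free two_K2 G \<longleftrightarrow> (\<forall>a b c d. \<not> ind_2K2 (parcs G) a b c d)"
proof -
  have "induced_free two_K2 G \<longleftrightarrow> \<not> (\<exists>a b c d. distinct [a, b, c, d] \<and> {a, b, c, d} \<subseteq> pverts G \<and>
      ind_2K2 (parcs G) a b c d)"
    unfolding two_K2_def
    by (subst induced_free_graph_on_iff[OF pair_graph_axioms], force, force,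
        unfold ex_list4, intro arg_cong[where f = Not] iff_exI)
      (simp add: numeral_eq_Suc all_less_Suc_nat ind_2K2_def, blast?)
  then show ?thesis using ind_2K2_distinct by blast
qed

lemma induced_free_C4_iff:
  "induced_free (cycle_graph 4) G \<longleftrightarrow> (\<forall>a b c d. \<not> ind_C4 (parcs G) a b c d)"
proof -
  have "induced_free (cycle_graph 4) G \<longleftrightarrow> \<not> (\<exists>a b c d. distinct [a, b, c, d] \<and> {a, b, c, d} \<subseteq> pverts G \<and>
      ind_C4 (parcs G) a b c d)"
    unfolding cycle_graph_numeral
    by (subst induced_free_graph_on_iff[OF pair_graph_axioms], force, force,
        unfold ex_list4, intro arg_cong[where f = Not] iff_exI)
      (simp add: numeral_eq_Suc all_less_Suc_nat ind_C4_def, blast?)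
  then show ?thesis using ind_C4_distinct by blast
qed

lemma pseudo_split_iff:
  "pseudo_split G \<longleftrightarrow> (\<forall>a b c d. \<not> ind_2K2 (parcs G) a b c d \<and> \<not> ind_C4 (parcs G) a b c d)"
  by (auto simp: pseudo_split_def induced_free_two_K2_iff induced_free_C4_iff)

lemma no_induced_C5:
  assumes "induced_free (cycle_graph 5) G"
    and "(a, b) \<in> parcs G" "(b, c) \<in> parcs G" "(c, d) \<in> parcs G" "(d, e) \<in> parcs G" "(a, e) \<in> parcs G"
    and "(a, c) \<notin> parcs G" "(a, d) \<notin> parcs G" "(b, d) \<notin> parcs G" "(b, e) \<notin> parcs G" "(c, e) \<notin> parcs G"
  shows False
proof -
  let ?xs = "[a, b, c, d, e]"
  let ?E = "{(0, 1), (1, 2), (2, 3), (3, 4), (4, 0)} :: (nat \<times> nat) set"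
  \<comment> \<open>Adjacent vertices differ because there are no loops; two non-adjacent vertices
    of a 5-cycle differ because some third vertex sees exactly one of them.\<close>
  have "distinct ?xs" "set ?xs \<subseteq> pverts G"
    using assms(2-) adj_sym adj_irrefl by (auto dest: in_arcsD1 in_arcsD2)
  then have "length ?xs = 5 \<and> distinct ?xs \<and> set ?xs \<subseteq> pverts G \<and>
      (\<forall>j<5. \<forall>i<j. (?xs ! i, ?xs ! j) \<in> parcs G \<longleftrightarrow> (i, j) \<in> ?E \<or> (j, i) \<in> ?E)"
    using assms(2-) by (simp add: numeral_eq_Suc all_less_Suc_nat)
  moreover have "?E \<subseteq> {..<5} \<times> {..<5}"
    by simp
  moreover have "(i, i) \<notin> ?E" for i
    by auto
  ultimately have "\<not> induced_free (graph_on 5 ?E) G"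
    by (subst induced_free_graph_on_iff[OF pair_graph_axioms]) (assumption, blast, metis)
  then show False
    using assms(1) by (simp add: cycle_graph_numeral)
qed

text \<open>The two rules generate all symmetries of 2K2, so any of its four vertices can be moved
  to the first place.\<close>

lemma ind_2K2_swap:
  "ind_2K2 (parcs G) a b c d \<Longrightarrow> ind_2K2 (parcs G) b a c d"
  "ind_2K2 (parcs G) a b c d \<Longrightarrow> ind_2K2 (parcs G) c d a b"
  using adj_sym by (auto simp: ind_2K2_def)

lemma ind_C4_rotate: "ind_C4 (parcs G) a b c d \<Longrightarrow> ind_C4 (parcs G) b c d a"
  using adj_sym by (auto simp: ind_C4_def)

section \<open>Recognition of the exceptional graphs\<close>

lemma digraph_iso_two_K2I:
  assumes "pverts G = {a, b, c, d}" "distinct [a, b, c, d]"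
    and "(a, b) \<in> parcs G" "(c, d) \<in> parcs G"
    and "(a, c) \<notin> parcs G" "(a, d) \<notin> parcs G" "(b, c) \<notin> parcs G"
      "(b, d) \<notin> parcs G"
  shows "digraph_iso (with_proj G) (with_proj two_K2)"
  unfolding two_K2_def
  by (rule digraph_iso_graph_onI[OF pair_graph_axioms, where xs = "[a, b, c, d]"],
      use assms(1,2) in simp, use assms(2) in simp, simp, (auto simp: graph_on_def)[2],
      use assms(3-) in \<open>simp add: graph_on_def all_less_numeral all_less_Suc_nat\<close>)

lemma digraph_iso_path_5I:
  assumes "pverts G = {a, b, c, d, e}" "distinct [a, b, c, d, e]"
    and "(a, b) \<in> parcs G" "(b, c) \<in> parcs G" "(c, d) \<in> parcs G" "(d, e) \<in> parcs G"
    and "(a, c) \<notin> parcs G" "(a, d) \<notin> parcs G" "(a, e) \<notin> parcs G"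
      "(b, d) \<notin> parcs G" "(b, e) \<notin> parcs G" "(c, e) \<notin> parcs G"
  shows "digraph_iso (with_proj G) (with_proj (path_graph 5))"
  unfolding path_graph_5
  by (rule digraph_iso_graph_onI[OF pair_graph_axioms, where xs = "[a, b, c, d, e]"],
      use assms(1,2) in simp, use assms(2) in simp, simp, (auto simp: graph_on_def)[2],
      use assms(3-) in \<open>simp add: graph_on_def all_less_numeral all_less_Suc_nat\<close>)

lemma digraph_iso_triangle_with_tailI:
  assumes "pverts G = {a, b, c, d, e}" "distinct [a, b, c, d, e]"
    and "(a, b) \<in> parcs G" "(a, c) \<in> parcs G" "(b, c) \<in> parcs G" "(c, d) \<in> parcs G"
      "(d, e) \<in> parcs G"
    and "(a, d) \<notin> parcs G" "(a, e) \<notin> parcs G" "(b, d) \<notin> parcs G"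
      "(b, e) \<notin> parcs G" "(c, e) \<notin> parcs G"
  shows "digraph_iso (with_proj G) (with_proj triangle_with_tail)"
  unfolding triangle_with_tail_def
  by (rule digraph_iso_graph_onI[OF pair_graph_axioms, where xs = "[a, b, c, d, e]"],
      use assms(1,2) in simp, use assms(2) in simp, simp, (auto simp: graph_on_def)[2],
      use assms(3-) in \<open>simp add: graph_on_def all_less_numeral all_less_Suc_nat\<close>)

lemma digraph_iso_bowtieI:
  assumes "pverts G = {a, b, c, d, e}" "distinct [a, b, c, d, e]"
    and "(a, b) \<in> parcs G" "(a, c) \<in> parcs G" "(b, c) \<in> parcs G" "(c, d) \<in> parcs G"
      "(c, e) \<in> parcs G" "(d, e) \<in> parcs G"
    and "(a, d) \<notin> parcs G" "(a, e) \<notin> parcs G" "(b, d) \<notin> parcs G"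
      "(b, e) \<notin> parcs G"
  shows "digraph_iso (with_proj G) (with_proj bowtie)"
  unfolding bowtie_def
  by (rule digraph_iso_graph_onI[OF pair_graph_axioms, where xs = "[a, b, c, d, e]"],
      use assms(1,2) in simp, use assms(2) in simp, simp, (auto simp: graph_on_def)[2],
      use assms(3-) in \<open>simp add: graph_on_def all_less_numeral all_less_Suc_nat\<close>)

lemma digraph_iso_cycle_6I:
  assumes "pverts G = {a, b, c, d, e, f}" "distinct [a, b, c, d, e, f]"
    and "(a, b) \<in> parcs G" "(a, f) \<in> parcs G" "(b, c) \<in> parcs G" "(c, d) \<in> parcs G"
      "(d, e) \<in> parcs G" "(e, f) \<in> parcs G"
    and "(a, c) \<notin> parcs G" "(a, d) \<notin> parcs G" "(a, e) \<notin> parcs G"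
      "(b, d) \<notin> parcs G" "(b, e) \<notin> parcs G" "(b, f) \<notin> parcs G"
      "(c, e) \<notin> parcs G" "(c, f) \<notin> parcs G" "(d, f) \<notin> parcs G"
  shows "digraph_iso (with_proj G) (with_proj (cycle_graph 6))"
  unfolding cycle_graph_numeral
  by (rule digraph_iso_graph_onI[OF pair_graph_axioms, where xs = "[a, b, c, d, e, f]"],
      use assms(1,2) in simp, use assms(2) in simp, simp, (auto simp: graph_on_def)[2],
      use assms(3-) in \<open>simp add: graph_on_def all_less_numeral all_less_Suc_nat\<close>)

lemma digraph_iso_wheel4I:
  assumes "pverts G = {a, b, c, d, e}" "distinct [a, b, c, d, e]"
    and "(a, b) \<in> parcs G" "(a, d) \<in> parcs G" "(a, e) \<in> parcs G" "(b, c) \<in> parcs G"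
      "(b, e) \<in> parcs G" "(c, d) \<in> parcs G" "(c, e) \<in> parcs G"
      "(d, e) \<in> parcs G"
    and "(a, c) \<notin> parcs G" "(b, d) \<notin> parcs G"
  shows "digraph_iso (with_proj G) (with_proj wheel4)"
  unfolding wheel4_def cycle_graph_numeral
  by (rule digraph_iso_graph_onI[OF pair_graph_axioms, where xs = "[a, b, c, d, e]"],
      use assms(1,2) in simp, use assms(2) in simp, simp, (auto simp: graph_on_def)[2],
      use assms(3-) in \<open>simp add: graph_on_def all_less_numeral all_less_Suc_nat\<close>)

text \<open>Consecutive entries form the parts, matching \<open>i div 2\<close>; when this is
  applied to a 4-cycle, opposite vertices must stand side by side.\<close>

lemma digraph_iso_K222I:
  assumes "pverts G = {a, b, c, d, e, f}" "distinct [a, b, c, d, e, f]"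
    and "(a, c) \<in> parcs G" "(a, d) \<in> parcs G" "(a, e) \<in> parcs G" "(a, f) \<in> parcs G"
      "(b, c) \<in> parcs G" "(b, d) \<in> parcs G" "(b, e) \<in> parcs G"
      "(b, f) \<in> parcs G" "(c, e) \<in> parcs G" "(c, f) \<in> parcs G"
      "(d, e) \<in> parcs G" "(d, f) \<in> parcs G"
    and "(a, b) \<notin> parcs G" "(c, d) \<notin> parcs G" "(e, f) \<notin> parcs G"
  shows "digraph_iso (with_proj G) (with_proj K222)"
  unfolding K222_def
  by (rule digraph_iso_graph_onI[OF pair_graph_axioms, where xs = "[a, b, c, d, e, f]"],
      use assms(1,2) in simp, use assms(2) in simp, simp, (auto simp: graph_on_def)[2],
      use assms(3-) in \<open>simp add: graph_on_def all_less_numeral all_less_Suc_nat\<close>)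

end

section \<open>Contractions of a pseudo-split graph without induced C5\<close>

lemma parcs_contract [simp]:
  "(Some x, Some y) \<in> parcs (contract G (u, v)) \<longleftrightarrow> (x, y) \<in> parcs G \<and> x \<notin> {u, v} \<and> y \<notin> {u, v}"
  "(None, Some y) \<in> parcs (contract G (u, v)) \<longleftrightarrow> y \<notin> {u, v} \<and> ((u, y) \<in> parcs G \<or> (v, y) \<in> parcs G)"
  "(Some x, None) \<in> parcs (contract G (u, v)) \<longleftrightarrow> x \<notin> {u, v} \<and> ((u, x) \<in> parcs G \<or> (v, x) \<in> parcs G)"
  "(None, None) \<notin> parcs (contract G (u, v))"
  by (auto simp: contract_def nbhd_def Let_def)

context pair_graph
begin

lemma pseudo_split_contract:
  assumes ps: "pseudo_split G" and C5: "induced_free (cycle_graph 5) G" and uv: "(u, v) \<in> parcs G"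
  shows "pseudo_split (contract G (u, v))"
proof -
  let ?C = "contract G (u, v)"
  interpret C: pair_graph ?C
    using pair_graph_axioms by (rule pair_graph_contract)
  have no_2K2: "\<not> ind_2K2 (parcs G) a b c d" and no_C4: "\<not> ind_C4 (parcs G) a b c d" for a b c d
    using ps by (auto simp: pseudo_split_iff)
  have "\<not> ind_2K2 (parcs ?C) None q r s" for q r s
  proof
    assume K: "ind_2K2 (parcs ?C) None q r s"
    then obtain x y z where "q = Some x" "r = Some y" "s = Some z"
      by (cases q; cases r; cases s) (auto simp: ind_2K2_def)
    \<comment> \<open>The end of \<open>uv\<close> that sees \<open>x\<close> takes the place of the
      new vertex; neither end sees \<open>y\<close> or \<open>z\<close>.\<close>
    with K have "ind_2K2 (parcs G) u x y z \<or> ind_2K2 (parcs G) v x y z"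
      by (auto simp: ind_2K2_def)
    with no_2K2 show False by blast
  qed
  moreover have "\<not> ind_2K2 (parcs ?C) (Some w) (Some x) (Some y) (Some z)" for w x y z
    using no_2K2[of w x y z] by (auto simp: ind_2K2_def)
  \<comment> \<open>By symmetry the new vertex, if it occurs, may be assumed to come first;
    otherwise the pattern already lies in \<open>G\<close>.\<close>
  ultimately have "\<not> ind_2K2 (parcs ?C) p q r s" for p q r s
    using C.ind_2K2_swap by (metis option.exhaust)
  moreover have "\<not> ind_C4 (parcs ?C) None q r s" for q r s
  proof
    assume K: "ind_C4 (parcs ?C) None q r s"
    then obtain x y z where "q = Some x" "r = Some y" "s = Some z"
      by (cases q; cases r; cases s) (auto simp: ind_C4_def)
    with K have K': "x \<noteq> u" "x \<noteq> v" "y \<noteq> u" "y \<noteq> v" "z \<noteq> u" "z \<noteq> v" "x \<noteq> z"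
      "(u, x) \<in> parcs G \<or> (v, x) \<in> parcs G" "(u, z) \<in> parcs G \<or> (v, z) \<in> parcs G"
      "(u, y) \<notin> parcs G" "(v, y) \<notin> parcs G" "(x, y) \<in> parcs G" "(y, z) \<in> parcs G"
      "(x, z) \<notin> parcs G"
      by (auto simp: ind_C4_def)
    \<comment> \<open>An end of \<open>uv\<close> seeing both \<open>x\<close> and \<open>z\<close>
      would replace the new vertex and give a C4 in \<open>G\<close>. So \<open>x\<close> and
      \<open>z\<close> are shared out between the two ends, and the edge \<open>uv\<close> closes an
      induced C5.\<close>
    have no_C4_uv: "\<not> ((u, x) \<in> parcs G \<and> (u, z) \<in> parcs G)"
      "\<not> ((v, x) \<in> parcs G \<and> (v, z) \<in> parcs G)"
      using K' no_C4[of u x y z] no_C4[of v x y z] by (auto simp: ind_C4_def)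
    have vu: "(v, u) \<in> parcs G"
      using uv adj_sym by blast
    consider "(u, x) \<in> parcs G" "(v, z) \<in> parcs G" | "(v, x) \<in> parcs G" "(u, z) \<in> parcs G"
      using K' no_C4_uv by blast
    then show False
    proof cases
      case 1
      then show False
        using K' no_C4_uv uv adj_sym by (intro no_induced_C5[OF C5, of u x y z v]) auto
    next
      case 2
      then show False
        using K' no_C4_uv vu adj_sym by (intro no_induced_C5[OF C5, of v x y z u]) auto
    qed
  qed
  moreover have "\<not> ind_C4 (parcs ?C) (Some w) (Some x) (Some y) (Some z)" for w x y z
    using no_C4[of w x y z] by (auto simp: ind_C4_def)
  ultimately show ?thesis
    unfolding C.pseudo_split_iff using C.ind_C4_rotate by (metis option.exhaust)
qed

end

section \<open>Graphs all of whose contractions are pseudo-split\<close>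

locale contraction_pseudo_split = pair_graph +
  assumes no_isolated: "no_isolated_vertices G"
    and contraction: "\<And>e. e \<in> parcs G \<Longrightarrow> pseudo_split (contract G e)"
begin

lemma contraction_no_2K2: "(u, v) \<in> parcs G \<Longrightarrow> \<not> ind_2K2 (parcs (contract G (u, v))) p q r s"
  and contraction_no_C4: "(u, v) \<in> parcs G \<Longrightarrow> \<not> ind_C4 (parcs (contract G (u, v))) p q r s"
  using contraction[of "(u, v)"] pair_graph.pseudo_split_iff[OF pair_graph_contract[OF pair_graph_axioms]]
  by blast+

lemma ex_neighbour: "v \<in> pverts G \<Longrightarrow> \<exists>w. (v, w) \<in> parcs G"
  using no_isolated by (auto simp: no_isolated_vertices_def nbhd_def)

section \<open>Vertices outside an induced 2K2\<close>

lemma outside_2K2_independent: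
  assumes "ind_2K2 (parcs G) a b c d" "x \<notin> {a, b, c, d}" "y \<notin> {a, b, c, d}"
  shows "(x, y) \<notin> parcs G"
  using assms contraction_no_2K2[of x y "Some a" "Some b" "Some c" "Some d"]
  by (auto simp: ind_2K2_def)

lemma outside_C4_independent:
  assumes "ind_C4 (parcs G) a b c d" "x \<notin> {a, b, c, d}" "y \<notin> {a, b, c, d}"
  shows "(x, y) \<notin> parcs G"
  using assms contraction_no_C4[of x y "Some a" "Some b" "Some c" "Some d"]
  by (auto simp: ind_C4_def)

text \<open>Contract \<open>ax\<close>: the new vertex still sees \<open>b\<close>, and if
  \<open>x\<close> missed both \<open>c\<close> and \<open>d\<close>, it would replace
  \<open>a\<close> in an induced 2K2.\<close>

lemma outside_2K2_adj_right:
  assumes K: "ind_2K2 (parcs G) a b c d" and x: "x \<notin> {a, b, c, d}" "(a, x) \<in> parcs G"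
  shows "(c, x) \<in> parcs G \<or> (d, x) \<in> parcs G"
  using assms contraction_no_2K2[of a x None "Some b" "Some c" "Some d"] adj_sym adj_irrefl
  by (auto simp: ind_2K2_def)

text \<open>As \<open>x\<close> is not isolated and outside vertices are independent,
  \<open>x\<close> sees one of the four vertices. Moving that vertex to the first place,
  \<open>outside_2K2_adj_right\<close> yields a neighbour on the other edge.\<close>

lemma outside_2K2_adj:
  assumes K: "ind_2K2 (parcs G) a b c d" and x: "x \<in> pverts G" "x \<notin> {a, b, c, d}"
  shows "(a, x) \<in> parcs G \<or> (b, x) \<in> parcs G" "(c, x) \<in> parcs G \<or> (d, x) \<in> parcs G"
proof -
  obtain w where w: "(w, x) \<in> parcs G"
    using ex_neighbour[OF x(1)] adj_sym by blast
  then have "w \<in> {a, b, c, d}"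
    using outside_2K2_independent[OF K _ x(2)] by blast
  moreover note ind_2K2_swap(1)[OF K] ind_2K2_swap(2)[OF K] ind_2K2_swap(1)[OF ind_2K2_swap(2)[OF K]]
  note this[THEN outside_2K2_adj_right, of x] outside_2K2_adj_right[OF K, of x]
  ultimately show "(a, x) \<in> parcs G \<or> (b, x) \<in> parcs G" "(c, x) \<in> parcs G \<or> (d, x) \<in> parcs G"
    using x w by auto
qed

text \<open>Contract \<open>ab\<close>: each of \<open>x\<close> and \<open>y\<close> sees
  \<open>a\<close> or \<open>b\<close>, hence the new vertex. If both also saw \<open>c\<close>, the
  new vertex, \<open>x\<close>, \<open>c\<close>, \<open>y\<close> would form an induced C4.\<close>

lemma outside_2K2_no_common_neighbour:
  assumes K: "ind_2K2 (parcs G) a b c d"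
    and x: "x \<in> pverts G" "x \<notin> {a, b, c, d}" and y: "y \<in> pverts G" "y \<notin> {a, b, c, d}"
    and "x \<noteq> y" "(c, x) \<in> parcs G"
  shows "(c, y) \<notin> parcs G"
  using assms contraction_no_C4[of a b None "Some x" "Some c" "Some y"] adj_sym adj_irrefl
    outside_2K2_independent[OF K x(2) y(2)] outside_2K2_adj[OF K x] outside_2K2_adj[OF K y]
  by (auto simp: ind_2K2_def ind_C4_def)

lemma outside_2K2_no_common_neighbour':
  assumes K: "ind_2K2 (parcs G) a b c d"
    and "x \<in> pverts G" "x \<notin> {a, b, c, d}" "y \<in> pverts G" "y \<notin> {a, b, c, d}" "x \<noteq> y"
    and e: "e \<in> {a, b, c, d}" "(e, x) \<in> parcs G"
  shows "(e, y) \<notin> parcs G"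
proof -
  note K' = ind_2K2_swap(1)[OF K] ind_2K2_swap(2)[OF K]
  note K'' = ind_2K2_swap(1)[OF K'(2)] ind_2K2_swap(2)[OF K'(1)]
  show ?thesis
    using assms outside_2K2_no_common_neighbour[OF K, of x y]
      outside_2K2_no_common_neighbour[OF K'(2), of x y]
      outside_2K2_no_common_neighbour[OF K''(2), of x y]
      outside_2K2_no_common_neighbour[OF ind_2K2_swap(2)[OF K''(1)], of x y]
    by auto
qed

text \<open>Only the pairs \<open>bx\<close> and \<open>dx\<close> are undecided: no edge gives the
  path, exactly one the triangle with a tail, both the bowtie.\<close>

lemma one_outside_2K2:
  assumes K: "ind_2K2 (parcs G) a b c d" and V: "pverts G = insert x {a, b, c, d}"
    and x: "x \<notin> {a, b, c, d}" "(a, x) \<in> parcs G" "(c, x) \<in> parcs G"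
  shows "\<exists>H \<in> {path_graph 5, triangle_with_tail, bowtie}. digraph_iso (with_proj G) (with_proj H)"
proof -
  note K' = K[unfolded ind_2K2_def] ind_2K2_distinct[OF K]
  note s = adj_sym[of x a] adj_sym[of x b] adj_sym[of x c] adj_sym[of x d] adj_sym[of b a] adj_sym[of d c]
    adj_sym[of c a] adj_sym[of d a] adj_sym[of c b] adj_sym[of d b]
  consider "(b, x) \<notin> parcs G" "(d, x) \<notin> parcs G" | "(b, x) \<in> parcs G" "(d, x) \<notin> parcs G"
    | "(b, x) \<notin> parcs G" "(d, x) \<in> parcs G" | "(b, x) \<in> parcs G" "(d, x) \<in> parcs G"
    by blast
  then show ?thesis
  proof cases
    case 1
    have "digraph_iso (with_proj G) (with_proj (path_graph 5))"
      by (rule digraph_iso_path_5I[of b a x c d]) (use K' x V s 1 in auto)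
    then show ?thesis by simp
  next
    case 2
    have "digraph_iso (with_proj G) (with_proj triangle_with_tail)"
      by (rule digraph_iso_triangle_with_tailI[of a b x c d]) (use K' x V s 2 in auto)
    then show ?thesis by simp
  next
    case 3
    have "digraph_iso (with_proj G) (with_proj triangle_with_tail)"
      by (rule digraph_iso_triangle_with_tailI[of c d x a b]) (use K' x V s 3 in auto)
    then show ?thesis by simp
  next
    case 4
    have "digraph_iso (with_proj G) (with_proj bowtie)"
      by (rule digraph_iso_bowtieI[of a b x c d]) (use K' x V s 4 in auto)
    then show ?thesis by simp
  qed
qed

text \<open>Since neighbourhoods are disjoint, \<open>y\<close> misses \<open>a\<close> and
  \<open>c\<close>, so it sees \<open>b\<close> and \<open>d\<close>, which \<open>x\<close> then
  misses. The hexagon is \<open>x\<close>, \<open>a\<close>, \<open>b\<close>, \<open>y\<close>,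
  \<open>d\<close>, \<open>c\<close>.\<close>

lemma two_outside_2K2:
  assumes K: "ind_2K2 (parcs G) a b c d"
    and x: "x \<in> pverts G" "x \<notin> {a, b, c, d}" "(a, x) \<in> parcs G" "(c, x) \<in> parcs G"
    and y: "y \<in> pverts G" "y \<notin> {a, b, c, d}" "x \<noteq> y"
  shows "digraph_iso (with_proj G) (with_proj (cycle_graph 6))"
proof -
  note K' = K[unfolded ind_2K2_def] ind_2K2_distinct[OF K]
  note disjoint = outside_2K2_no_common_neighbour'[OF K]
  have nay: "(a, y) \<notin> parcs G" and ncy: "(c, y) \<notin> parcs G"
    using disjoint[OF x(1,2) y] x by auto
  then have aby: "(b, y) \<in> parcs G" and ady: "(d, y) \<in> parcs G"
    using outside_2K2_adj[OF K y(1,2)] by auto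
  then have bx: "(b, x) \<notin> parcs G" and dx: "(d, x) \<notin> parcs G"
    using disjoint[OF y(1,2) x(1,2)] y by auto
  have xy: "(x, y) \<notin> parcs G"
    using outside_2K2_independent[OF K x(2) y(2)] .
  \<comment> \<open>A third outside vertex would see \<open>a\<close> or \<open>b\<close>, but these
    are already neighbours of \<open>x\<close> and \<open>y\<close> respectively.\<close>
  have "z \<in> {a, b, c, d, x, y}" if z: "z \<in> pverts G" for z
  proof (rule ccontr)
    assume "z \<notin> {a, b, c, d, x, y}"
    then show False
      using outside_2K2_adj(1)[OF K z] disjoint[OF x(1,2) z] disjoint[OF y(1,2) z] x(3) aby
      by auto
  qed
  then have V: "pverts G = {x, a, b, y, d, c}"
    using x(1) y(1) K' by blast
  note s = adj_sym[of x a] adj_sym[of x b] adj_sym[of x c] adj_sym[of x d] adj_sym[of y d] adj_sym[of y c]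
    adj_sym[of d c]
  show ?thesis
    by (rule digraph_iso_cycle_6I[OF V]) (use K' x y nay aby ncy ady bx dx xy s in auto)
qed

lemma ind_2K2_imp_exceptional:
  assumes K: "ind_2K2 (parcs G) a b c d"
  shows "\<exists>H \<in> {two_K2, path_graph 5, triangle_with_tail, bowtie, cycle_graph 6}.
    digraph_iso (with_proj G) (with_proj H)" (is ?exc)
proof (cases "pverts G = {a, b, c, d}")
  case True
  have "digraph_iso (with_proj G) (with_proj two_K2)"
    by (rule digraph_iso_two_K2I[OF True]) (use K ind_2K2_distinct[OF K] in \<open>auto simp: ind_2K2_def\<close>)
  then show ?thesis by simp
next
  case False
  then obtain x where x: "x \<in> pverts G" "x \<notin> {a, b, c, d}"
    using ind_2K2_distinct[OF K] by blast
  \<comment> \<open>An outside vertex sees an end of each edge; renaming within the edges makes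
    these ends \<open>a\<close> and \<open>c\<close>. The four orderings of \<open>K\<close> used
    below cover all choices.\<close>
  have wlog: ?exc
    if K: "ind_2K2 (parcs G) a b c d" and x': "x \<notin> {a, b, c, d}" "(a, x) \<in> parcs G" "(c, x) \<in> parcs G"
    for a b c d
  proof (cases "\<exists>y. y \<in> pverts G \<and> y \<notin> {a, b, c, d} \<and> x \<noteq> y")
    case True
    then show ?thesis
      using two_outside_2K2[OF K x(1) x'] by blast
  next
    case False
    then have "pverts G = insert x {a, b, c, d}"
      using x(1) ind_2K2_distinct[OF K] by blast
    then show ?thesis
      using one_outside_2K2[OF K _ x'] by blast
  qed
  note K' = ind_2K2_swap(1)[OF K] ind_2K2_swap(2)[OF ind_2K2_swap(1)[OF ind_2K2_swap(2)[OF K]]]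
  note K'' = ind_2K2_swap(1)[OF K'(2)]
  show ?thesis
    using outside_2K2_adj[OF K x] wlog[OF K] wlog[OF K'(1)] wlog[OF K'(2)] wlog[OF K''] x(2)
    by blast
qed

section \<open>Vertices outside an induced C4\<close>

lemma outside_C4_opposite:
  assumes K: "ind_C4 (parcs G) a b c d" and x: "x \<notin> {a, b, c, d}" "(a, x) \<in> parcs G"
  shows "(c, x) \<in> parcs G"
  \<comment> \<open>If \<open>x\<close> missed \<open>c\<close>, the vertex obtained from
    \<open>ax\<close> would replace \<open>a\<close> in the 4-cycle.\<close>
  using assms contraction_no_C4[of a x None "Some b" "Some c" "Some d"] adj_sym adj_irrefl
  by (auto simp: ind_C4_def)

lemma outside_C4_opposite_iff:
  assumes K: "ind_C4 (parcs G) a b c d" and x: "x \<notin> {a, b, c, d}"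
  shows "(a, x) \<in> parcs G \<longleftrightarrow> (c, x) \<in> parcs G" "(b, x) \<in> parcs G \<longleftrightarrow> (d, x) \<in> parcs G"
proof -
  note K1 = ind_C4_rotate[OF K]
  note K2 = ind_C4_rotate[OF K1]
  note K3 = ind_C4_rotate[OF K2]
  show "(a, x) \<in> parcs G \<longleftrightarrow> (c, x) \<in> parcs G" "(b, x) \<in> parcs G \<longleftrightarrow> (d, x) \<in> parcs G"
    using x outside_C4_opposite[OF K, of x] outside_C4_opposite[OF K1, of x]
      outside_C4_opposite[OF K2, of x] outside_C4_opposite[OF K3, of x]
    by auto
qed

lemma outside_C4_adj:
  assumes K: "ind_C4 (parcs G) a b c d" and x: "x \<in> pverts G" "x \<notin> {a, b, c, d}"
  shows "(a, x) \<in> parcs G \<or> (b, x) \<in> parcs G"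
proof -
  obtain w where w: "(w, x) \<in> parcs G"
    using ex_neighbour[OF x(1)] adj_sym by blast
  then have "w \<in> {a, b, c, d}"
    using outside_C4_independent[OF K _ x(2)] by blast
  then show ?thesis
    using w outside_C4_opposite_iff[OF K x(2)] by blast
qed

text \<open>If \<open>y\<close> missed \<open>a\<close>, it would see \<open>b\<close> and
  \<open>d\<close>. Contracting \<open>ax\<close> would then make the new vertex and
  \<open>y\<close> opposite corners of an induced C4 through \<open>b\<close> and
  \<open>d\<close>.\<close>

lemma outside_C4_same_type:
  assumes K: "ind_C4 (parcs G) a b c d"
    and x: "x \<in> pverts G" "x \<notin> {a, b, c, d}" "(a, x) \<in> parcs G"
    and y: "y \<in> pverts G" "y \<notin> {a, b, c, d}"
  shows "(a, y) \<in> parcs G"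
proof (rule ccontr)
  assume ay: "(a, y) \<notin> parcs G"
  then have "(b, y) \<in> parcs G" "(d, y) \<in> parcs G"
    using outside_C4_adj[OF K y] outside_C4_opposite_iff[OF K y(2)] by auto
  then show False
    using K x y ay contraction_no_C4[of a x None "Some b" "Some y" "Some d"] adj_sym
      outside_C4_independent[OF K x(2) y(2)]
    by (auto simp: ind_C4_def)
qed

text \<open>Both \<open>y\<close> and \<open>z\<close> see \<open>b\<close>, hence also
  \<open>d\<close>, so \<open>b\<close>, \<open>y\<close>, \<open>d\<close>, \<open>z\<close> form
  an induced C4, which survives contracting the disjoint edge \<open>ax\<close>. This leaves at most
  two outside vertices when all are complete to the cycle.\<close>

lemma outside_C4_complete_card:
  assumes K: "ind_C4 (parcs G) a b c d"
    and "x \<notin> {a, b, c, d}" "y \<notin> {a, b, c, d}" "z \<notin> {a, b, c, d}" "distinct [x, y, z]"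
    and "(a, x) \<in> parcs G" "(b, y) \<in> parcs G" "(b, z) \<in> parcs G"
  shows False
  using assms contraction_no_C4[of a x "Some b" "Some y" "Some d" "Some z"] adj_sym
    outside_C4_opposite_iff[OF K assms(3)] outside_C4_opposite_iff[OF K assms(4)]
    outside_C4_independent[OF K assms(3,4)]
  by (auto simp: ind_C4_def)

text \<open>Every outside vertex misses \<open>a\<close> and \<open>c\<close>, hence sees
  \<open>b\<close> and \<open>d\<close>. One side is \<open>{b, d}\<close>; the other consists of
  all remaining vertices, and its size \<open>m\<close> is at least 2 because of \<open>a\<close>
  and \<open>c\<close>.\<close>

lemma outside_C4_imp_K2m:
  assumes K: "ind_C4 (parcs G) a b c d"
    and out: "\<And>x. x \<in> pverts G \<Longrightarrow> x \<notin> {a, b, c, d} \<Longrightarrow> (a, x) \<notin> parcs G"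
  shows "\<exists>m\<ge>2. K\<^bsub>2,m\<^esub> (with_proj G)"
proof -
  let ?V = "pverts G - {b, d}"
  note K' = K[unfolded ind_C4_def] ind_C4_distinct[OF K]
  have adj: "(x, y) \<in> parcs G" if "x \<in> {b, d}" "y \<in> ?V" for x y
  proof (cases "y \<in> {a, c}")
    case True
    then show ?thesis using K' that adj_sym by auto
  next
    case False
    then show ?thesis
      using that out[of y] outside_C4_adj[OF K, of y] outside_C4_opposite_iff[OF K, of y] by auto
  qed
  have no_bd: "(x, y) \<notin> parcs G" if "x \<in> {b, d}" "y \<in> {b, d}" for x y
    using that K' adj_sym adj_irrefl by auto
  have no_V: "(x, y) \<notin> parcs G" if "x \<in> ?V" "y \<in> ?V" for x y
  proof -
    \<comment> \<open>Outside vertices are independent of each other, so only pairs containing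
      \<open>a\<close> or \<open>c\<close> remain.\<close>
    have no_ac: "(w, y) \<notin> parcs G" if "w \<in> {a, c}" "y \<in> ?V" for w y
      using that K' adj_sym adj_irrefl out[of y] outside_C4_opposite_iff[OF K, of y]
      by (cases "y \<in> {a, c}") auto
    show ?thesis
      using no_ac[of x y] no_ac[of y x] that adj_sym[of x y] outside_C4_independent[OF K, of x y]
      by auto
  qed
  have "parcs G = {b, d} \<times> ?V \<union> ?V \<times> {b, d}"
  proof (intro equalityI subrelI)
    fix x y assume xy: "(x, y) \<in> parcs G"
    then have "x \<in> pverts G" "y \<in> pverts G"
      by (auto dest: in_arcsD1 in_arcsD2)
    with xy show "(x, y) \<in> {b, d} \<times> ?V \<union> ?V \<times> {b, d}"
      using no_bd no_V by blast
  qed (use adj adj_sym in blast)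
  moreover have "pverts G = {b, d} \<union> ?V" "{b, d} \<inter> ?V = {}" "card {b, d} = 2"
    using K' by auto
  ultimately have "K\<^bsub>2,card ?V\<^esub> (with_proj G)"
    using pair_finite_verts unfolding complete_bipartite_digraph_pair_def by blast
  moreover have "card {a, c} \<le> card ?V"
    using K' pair_finite_verts by (intro card_mono) auto
  then have "card ?V \<ge> 2"
    using K' by simp
  ultimately show ?thesis by blast
qed

lemma ind_C4_imp_exceptional:
  assumes K: "ind_C4 (parcs G) a b c d"
  shows "(\<exists>m\<ge>2. K\<^bsub>2,m\<^esub> (with_proj G)) \<or> digraph_iso (with_proj G) (with_proj wheel4) \<or>
    digraph_iso (with_proj G) (with_proj K222)"
proof (rule ccontr)
  assume contr: "\<not> ?thesis"
  note K' = K[unfolded ind_C4_def] ind_C4_distinct[OF K]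
  note K1 = ind_C4_rotate[OF K]
  obtain x where x: "x \<in> pverts G" "x \<notin> {a, b, c, d}" "(a, x) \<in> parcs G"
    using outside_C4_imp_K2m[OF K] contr by blast
  obtain y where y: "y \<in> pverts G" "y \<notin> {b, c, d, a}" "(b, y) \<in> parcs G"
    using outside_C4_imp_K2m[OF K1] contr by blast
  have all: "(a, z) \<in> parcs G" "(b, z) \<in> parcs G" "(c, z) \<in> parcs G" "(d, z) \<in> parcs G"
    if z: "z \<in> pverts G" "z \<notin> {a, b, c, d}" for z
    using outside_C4_same_type[OF K x z] outside_C4_same_type[OF K1 y, of z]
      outside_C4_opposite_iff[OF K z(2)] z by auto
  show False
  proof (cases "pverts G = {a, b, c, d, x}")
    case True
    have "digraph_iso (with_proj G) (with_proj wheel4)"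
      by (rule digraph_iso_wheel4I[OF True]) (use K' x all[OF x(1,2)] in auto)
    with contr show False by blast
  next
    case False
    then obtain u where u: "u \<in> pverts G" "u \<notin> {a, b, c, d}" "u \<noteq> x"
      using K' x(1) by blast
    have "z \<in> {a, b, c, d, x, u}" if "z \<in> pverts G" for z
      using outside_C4_complete_card[OF K x(2) u(2), of z] that u(3) all[of z] all[OF x(1,2)] all[OF u(1,2)]
      by auto
    \<comment> \<open>The parts are the two opposite pairs of the cycle and the non-adjacent pair
      \<open>x\<close>, \<open>u\<close>.\<close>
    then have V: "pverts G = {a, c, b, d, x, u}"
      using K' x(1) u(1) by blast
    have "digraph_iso (with_proj G) (with_proj K222)"
      by (rule digraph_iso_K222I[OF V])
        (use K' x u all[OF x(1,2)] all[OF u(1,2)] adj_sym[of c b] outside_C4_independent[OF K x(2) u(2)] in auto)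
    with contr show False by blast
  qed
qed

end

theorem theorem39:
  fixes G :: "'a pair_pre_digraph"
  assumes "pair_graph G"
    and "no_isolated_vertices G"
    and "induced_free (cycle_graph 5) G"
    and "\<not> (\<exists>m\<ge>2. K\<^bsub>2,m\<^esub> (with_proj G))"
    and "\<not> digraph_iso (with_proj G) (with_proj wheel4)"
    and "\<not> digraph_iso (with_proj G) (with_proj K222)"
    and "\<not> digraph_iso (with_proj G) (with_proj (cycle_graph 6))"
    and "\<not> digraph_iso (with_proj G) (with_proj two_K2)"
    and "\<not> digraph_iso (with_proj G) (with_proj (path_graph 5))"
    and "\<not> digraph_iso (with_proj G) (with_proj triangle_with_tail)"
    and "\<not> digraph_iso (with_proj G) (with_proj bowtie)"
  shows "pseudo_split G \<longleftrightarrow> (\<forall>e \<in> parcs G. pseudo_split (contract G e))"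
proof
  interpret pair_graph G by fact
  assume "pseudo_split G"
  then show "\<forall>e \<in> parcs G. pseudo_split (contract G e)"
    using pseudo_split_contract assms(3) by auto
next
  assume "\<forall>e \<in> parcs G. pseudo_split (contract G e)"
  then interpret contraction_pseudo_split G
    using assms(1,2) by (simp add: contraction_pseudo_split_def contraction_pseudo_split_axioms_def)
  show "pseudo_split G"
    unfolding pseudo_split_iff
    using ind_2K2_imp_exceptional ind_C4_imp_exceptional assms(4-) by blast
qed

end
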